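(* Let $n,k\geq 1$ and let $\psi=(\phi_1,\ldots,\phi_n;\sigma):\mathbb{Z}^k\to (\mathbb{Z}^k)^n\rtimes \Sigma_n$ be an irreducible group morphism, with associated subgroup $S\subseteq\mathbb{Z}^k$, numbers $n_{\bar z}$ ($\bar z\in\mathbb{Z}^k$) and morphism $\phi:S\to\mathbb{Z}^k$. Then $\psi$ can be induced by an affine $n$-valued map if and only if $\phi(n_{\bar z}\bar z)\notin n_{\bar z}\mathbb{Z}^k$ for every $\bar z\in\mathbb{Z}^k$ with $\bar z\notin S$.
   Context: $\Sigma_n$ is the symmetric group on $\{1,\ldots,n\}$. The product in $(\mathbb{Z}^k)^n\rtimes\Sigma_n$ is $(\alpha_1,\ldots,\alpha_n;\sigma)(\beta_1,\ldots,\beta_n;\tau)=(\alpha_1+\beta_{\sigma^{-1}(1)},\ldots,\alpha_n+\beta_{\sigma^{-1}(n)};\sigma\tau)$. A group morphism $\psi:\mathbb{Z}^k\to(\mathbb{Z}^k)^n\rtimes\Sigma_n$ is written $\psi=(\phi_1,\ldots,\phi_n;\sigma)$, meaning $\psi(\bar z)=(\phi_1(\bar z),\ldots,\phi_n(\bar z);\sigma_{\bar z})$; here $\sigma:\bar z\mapsto\sigma_{\bar z}\in\Sigma_n$ is a morphism, and the $\phi_i:\mathbb{Z}^k\to\mathbb{Z}^k$ are maps, not necessarily morphisms. $S_i=\{\bar z\in\mathbb{Z}^k\mid\sigma_{\bar z}(i)=i\}$, and $n_{i\bar z}$ is the length of the cycle containing $i$ in the disjoint cycle decomposition of $\sigma_{\bar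 z}$ (equal to $1$ if $\sigma_{\bar z}(i)=i$); one has $n_{i\bar z}\bar z\in S_i$. The morphism $\psi$ is irreducible if for all $i,j\in\{1,\ldots,n\}$ there is $\bar z\in\mathbb{Z}^k$ with $\sigma_{\bar z}(i)=j$. For irreducible $\psi$, the subgroup $S_i$, the numbers $n_{i\bar z}$ and the restriction $\phi_i|_{S_i}:S_i\to\mathbb{Z}^k$ (a group morphism) do not depend on $i$, and they are denoted $S$, $n_{\bar z}$ and $\phi:S\to\mathbb{Z}^k$ respectively. $T^k$ is the $k$-torus with universal covering $p:\mathbb{R}^k\to T^k$, $p(t_1,\ldots,t_k)=(e^{2\pi i t_1},\ldots,e^{2\pi i t_k})$, and covering group $\mathbb{Z}^k$ acting by translations. $D_n(T^k)$ is the space of sets of $n$ distinct points of $T^k$, topologised as the quotient of the ordered configuration space $F_n(T^k)\subseteq (T^k)^n$ by the permutation action of $\Sigma_n$; an $n$-valued map of $T^k$ is a continuous map $f:T^k\to D_n(T^k)$. Let $F_n(\mathbb{R}^k,\mathbb{Z}^k)=\{(\tilde x_1,\ldots,\tilde x_n)\in(\mathbb{R}^k)^n\mid p(\tilde x_i)\neq p(\tilde x_j)\text{ if }i\neq j\}$, with covering map $p^n:F_n(\mathbb{R}^k,\mathbb{Z}^k)\to D_n(T^k)$, $(\tilde x_1,\ldots,\tilde x_n)\mapsto\{p(\tilde x_1),\ldots,p(\tilde x_n)\}$. A lift of $f$ is a continuous map $\tilde f=(\tilde f_1,\ldots,\tilde f_n):\mathbb{R}^k\to F_n(\mathbb{R}^k,\mathbb{Z}^k)$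 with $p^n\circ\tilde f=f\circ p$; the maps $\tilde f_i:\mathbb{R}^k\to\mathbb{R}^k$ are its lift-factors. A lift $\tilde f$ induces a unique morphism $\psi_{\tilde f}=(\phi_1,\ldots,\phi_n;\sigma):\mathbb{Z}^k\to(\mathbb{Z}^k)^n\rtimes\Sigma_n$ satisfying $\tilde f_i(\bar t+\bar z)=\tilde f_{(\sigma_{\bar z})^{-1}(i)}(\bar t)+\phi_i(\bar z)$ for all $i$, all $\bar t\in\mathbb{R}^k$ and all $\bar z\in\mathbb{Z}^k$. The map $f$ is affine if it has a lift all of whose lift-factors are affine maps $\bar t\mapsto A_i\bar t+\bar a_i$ with $A_i\in\mathbb{R}^{k\times k}$, $\bar a_i\in\mathbb{R}^k$. A morphism $\psi$ is induced by an affine ($n$-valued) map if there is an affine $f:T^k\to D_n(T^k)$ and a lift $\tilde f$ of $f$ with $\psi_{\tilde f}=\psi$. *)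

theory Defs
  imports "HOL-Analysis.Analysis" "HOL-Algebra.Group" "HOL-Combinatorics.Orbits"
begin

text \<open>
  Throughout, the finite type \<open>'k\<close> indexes the coordinates of \<open>\<real>\<^sup>k\<close>, \<open>\<int>\<^sup>k\<close> and \<open>T\<^sup>k\<close>, so
  \<open>k = CARD('k)\<close>, and the finite type \<open>'n\<close> replaces the label set \<open>{1,\<dots>,n}\<close>, so \<open>n = CARD('n)\<close>.
  Types are nonempty, hence \<open>n, k \<ge> 1\<close>.
\<close>

section \<open>The groups \<open>\<int>\<^sup>k\<close> and \<open>(\<int>\<^sup>k)\<^sup>n \<rtimes> \<Sigma>\<^sub>n\<close>\<close>

text \<open>HOL-Algebra takes the name \<open>inv\<close> for inverses in a group.\<close>
abbreviation inv' :: "('a \<Rightarrow> 'b) \<Rightarrow> 'b \<Rightarrow> 'a" where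
  "inv' \<equiv> Hilbert_Choice.inv"

definition Zk_group :: "(int^'k) monoid" where
  "Zk_group = \<lparr>carrier = UNIV, mult = (+), one = 0\<rparr>"

definition semidirect_group :: "(((int^'k)^'n) \<times> ('n \<Rightarrow> 'n)) monoid" where
  "semidirect_group =
     \<lparr>carrier = {(\<alpha>, \<sigma>). \<sigma> permutes UNIV},
      mult = (\<lambda>(\<alpha>, \<sigma>) (\<beta>, \<tau>). (\<chi> i. \<alpha> $ i + \<beta> $ (inv' \<sigma> i), \<sigma> \<circ> \<tau>)),
      one = (0, id)\<rparr>"

lemma group_Zk_group: "group Zk_group"
proof (rule groupI)
  fix x :: "int^'k"
  show "\<exists>y\<in>carrier Zk_group. y \<otimes>\<^bsub>Zk_group\<^esub> x = \<one>\<^bsub>Zk_group\<^esub>"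
    by (rule bexI[of _ "- x"]) (auto simp: Zk_group_def)
qed (auto simp: Zk_group_def)

lemma group_semidirect_group:
  "group (semidirect_group :: (((int^'k)^'n::finite) \<times> ('n \<Rightarrow> 'n)) monoid)" (is "group ?G")
proof (rule groupI)
  fix x y assume "x \<in> carrier ?G" "y \<in> carrier ?G"
  then show "x \<otimes>\<^bsub>?G\<^esub> y \<in> carrier ?G"
    by (auto simp: semidirect_group_def intro: permutes_compose)
next
  show "\<one>\<^bsub>?G\<^esub> \<in> carrier ?G"
    by (auto simp: semidirect_group_def permutes_id)
next
  fix x y z assume "x \<in> carrier ?G" "y \<in> carrier ?G" "z \<in> carrier ?G"
  then show "x \<otimes>\<^bsub>?G\<^esub> y \<otimes>\<^bsub>?G\<^esub> z = x \<otimes>\<^bsub>?G\<^esub> (y \<otimes>\<^bsub>?G\<^esub> z)"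
    by (auto simp: semidirect_group_def vec_eq_iff o_inv_distrib permutes_bij algebra_simps o_assoc)
next
  fix x assume "x \<in> carrier ?G"
  then show "\<one>\<^bsub>?G\<^esub> \<otimes>\<^bsub>?G\<^esub> x = x"
    by (auto simp: semidirect_group_def vec_eq_iff)
next
  fix x assume x: "x \<in> carrier ?G"
  obtain a s where as: "x = (a, s)" by (cases x)
  have s: "s permutes UNIV" using x as by (auto simp: semidirect_group_def)
  have "inv' (inv' s) i = s i" for i
    using permutes_inv_inv[OF s] by simp
  then have "(\<chi> i. - a $ (s i), inv' s) \<otimes>\<^bsub>?G\<^esub> x = \<one>\<^bsub>?G\<^esub>"
    using permutes_inv_o(2)[OF s] by (simp add: as semidirect_group_def vec_eq_iff)
  moreover have "(\<chi> i. - a $ (s i), inv' s) \<in> carrier ?G"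
    using permutes_inv[OF s] by (simp add: semidirect_group_def)
  ultimately show "\<exists>y\<in>carrier ?G. y \<otimes>\<^bsub>?G\<^esub> x = \<one>\<^bsub>?G\<^esub>"
    by blast
qed

section \<open>Morphisms \<open>\<psi> = (\<phi>\<^sub>1,\<dots>,\<phi>\<^sub>n;\<sigma>)\<close>\<close>

type_synonym ('k, 'n) morphism = "int^'k \<Rightarrow> ((int^'k)^'n) \<times> ('n \<Rightarrow> 'n)"

definition phi_at :: "('k::finite, 'n) morphism \<Rightarrow> 'n::finite \<Rightarrow> int^'k \<Rightarrow> int^'k" where
  "phi_at \<psi> i z = fst (\<psi> z) $ i"

definition sigma :: "('k::finite, 'n) morphism \<Rightarrow> int^'k \<Rightarrow> 'n \<Rightarrow> 'n" where
  "sigma \<psi> z = snd (\<psi> z)"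

definition stab_at :: "('k::finite, 'n) morphism \<Rightarrow> 'n \<Rightarrow> (int^'k) set" where
  "stab_at \<psi> i = {z. sigma \<psi> z i = i}"

text \<open>The entries of the cycle of a permutation through \<open>i\<close> form the orbit of \<open>i\<close>.\<close>
definition cycle_len_at :: "('k::finite, 'n) morphism \<Rightarrow> 'n \<Rightarrow> int^'k \<Rightarrow> nat" where
  "cycle_len_at \<psi> i z = card (orbit (sigma \<psi> z) i)"

definition irreducible_morphism :: "('k::finite, 'n) morphism \<Rightarrow> bool" where
  "irreducible_morphism \<psi> \<longleftrightarrow> (\<forall>i j. \<exists>z. sigma \<psi> z i = j)"

text \<open>
  The common values of \<open>S\<^sub>i\<close>, \<open>n\<^sub>i\<^sub>z\<close> and \<open>\<phi>\<^sub>i\<close> on \<open>S\<close>. They exist for irreducible morphisms: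
  see \<open>stab_eq\<close>, \<open>cycle_len_eq\<close> and \<open>phi_eq\<close> below. Off \<open>S\<close>, the value of \<open>phi\<close> has no meaning.
\<close>
definition stab :: "('k::finite, 'n) morphism \<Rightarrow> (int^'k) set" where
  "stab \<psi> = (THE A. \<forall>i. stab_at \<psi> i = A)"

definition cycle_len :: "('k::finite, 'n) morphism \<Rightarrow> int^'k \<Rightarrow> nat" where
  "cycle_len \<psi> z = (THE m. \<forall>i. cycle_len_at \<psi> i z = m)"

definition phi :: "('k::finite, 'n::finite) morphism \<Rightarrow> int^'k \<Rightarrow> int^'k" where
  "phi \<psi> z = (THE w. \<forall>i. phi_at \<psi> i z = w)"

context
  fixes \<psi> :: "('k::finite, 'n::finite) morphism"
  assumes hom: "\<psi> \<in> hom Zk_group semidirect_group"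
begin

lemma sigma_permutes: "sigma \<psi> z permutes UNIV"
  using hom by (auto simp: hom_def Pi_def Zk_group_def semidirect_group_def sigma_def split_beta)

lemma morphism_add:
  "\<psi> (z + w) = (\<chi> i. phi_at \<psi> i z + phi_at \<psi> (inv' (sigma \<psi> z) i) w, sigma \<psi> z \<circ> sigma \<psi> w)"
  using hom
  by (auto simp: hom_def Zk_group_def semidirect_group_def sigma_def phi_at_def split_beta)

lemma sigma_add: "sigma \<psi> (z + w) = sigma \<psi> z \<circ> sigma \<psi> w"
  by (simp add: morphism_add sigma_def[of _ "z + w"])

lemma phi_at_add: "phi_at \<psi> i (z + w) = phi_at \<psi> i z + phi_at \<psi> (inv' (sigma \<psi> z) i) w"
  by (simp add: morphism_add phi_at_def[of _ _ "z + w"])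

lemma sigma_commute: "sigma \<psi> z (sigma \<psi> w i) = sigma \<psi> w (sigma \<psi> z i)"
  by (metis add.commute comp_apply sigma_add)

lemma sigma_zero: "sigma \<psi> 0 = id"
proof -
  have "inv' (sigma \<psi> 0) \<circ> (sigma \<psi> 0 \<circ> sigma \<psi> 0) = inv' (sigma \<psi> 0) \<circ> sigma \<psi> 0"
    using sigma_add[of 0 0] by simp
  then show ?thesis
    using permutes_inv_o(2)[OF sigma_permutes[of 0]] by (simp flip: comp_assoc)
qed

lemma sigma_of_nat: "sigma \<psi> (of_nat m *s z) = sigma \<psi> z ^^ m"
proof (induction m)
  case 0
  show ?case by (simp add: sigma_zero)
next
  case (Suc m)
  have "of_nat (Suc m) *s z = z + of_nat m *s z"
    by (simp add: vec_eq_iff algebra_simps)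
  then show ?case by (simp only: sigma_add Suc.IH funpow.simps)
qed

lemma cycle_len_at_sigma: "cycle_len_at \<psi> (sigma \<psi> w i) z = cycle_len_at \<psi> i z"
proof -
  have pow: "(sigma \<psi> z ^^ m) (sigma \<psi> w i) = sigma \<psi> w ((sigma \<psi> z ^^ m) i)" for m
    by (induction m) (simp_all add: sigma_commute)
  have "orbit (sigma \<psi> z) (sigma \<psi> w i) = sigma \<psi> w ` orbit (sigma \<psi> z) i"
    unfolding orbit_altdef pow by auto
  then show ?thesis
    unfolding cycle_len_at_def
    by (simp add: card_image permutes_inj_on[OF sigma_permutes])
qed

lemma cycle_len_at_in_stab_at: "of_nat (cycle_len_at \<psi> i z) *s z \<in> stab_at \<psi> i"
proof -
  let ?s = "sigma \<psi> z"
  have "permutation ?s"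
    using sigma_permutes by (auto simp: permutation_permutes)
  then have i: "i \<in> orbit ?s i"
    by (rule permutation_self_in_orbit)
  have "orbit ?s i = (\<lambda>m. (?s ^^ m) i) ` {0..<funpow_dist1 ?s i i}"
    by (rule orbit_conv_funpow_dist1[OF i])
  moreover have "inj_on (\<lambda>m. (?s ^^ m) i) {0..<funpow_dist1 ?s i i}"
    by (rule inj_on_funpow_dist1[OF i])
  ultimately have "card (orbit ?s i) = funpow_dist1 ?s i i"
    by (simp only: card_image card_atLeastLessThan)
  then show ?thesis
    using funpow_dist1_prop[OF i] by (simp only: stab_at_def cycle_len_at_def sigma_of_nat mem_Collect_eq)
qed

context
  assumes irr: "irreducible_morphism \<psi>"
begin

lemma stab_eq: "stab \<psi> = stab_at \<psi> i"
proof -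
  have "stab_at \<psi> j = stab_at \<psi> i" for j
  proof -
    obtain w where "sigma \<psi> w i = j" using irr by (auto simp: irreducible_morphism_def)
    then show ?thesis
      using inj_eq[OF permutes_inj[OF sigma_permutes[of w]]]
      by (auto simp: stab_at_def sigma_commute[of _ w])
  qed
  then show ?thesis unfolding stab_def by (intro the_equality) auto
qed

lemma cycle_len_eq: "cycle_len \<psi> z = cycle_len_at \<psi> i z"
proof -
  have "cycle_len_at \<psi> j z = cycle_len_at \<psi> i z" for j
    using irr cycle_len_at_sigma by (metis irreducible_morphism_def)
  then show ?thesis unfolding cycle_len_def by (intro the_equality) auto
qed

lemma phi_eq:
  assumes "z \<in> stab \<psi>"
  shows "phi \<psi> z = phi_at \<psi> i z"
proof -
  have "phi_at \<psi> j z = phi_at \<psi> i z" for j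
  proof -
    obtain w where w: "sigma \<psi> w j = i" using irr by (auto simp: irreducible_morphism_def)
    have "inv' (sigma \<psi> w) i = j"
      using w permutes_inverses(2)[OF sigma_permutes] by metis
    moreover have "sigma \<psi> z i = i"
      using assms stab_eq[of i] by (auto simp: stab_at_def)
    then have "inv' (sigma \<psi> z) i = i"
      using permutes_inverses(2)[OF sigma_permutes] by metis
    ultimately show ?thesis
      using phi_at_add[of i w z] phi_at_add[of i z w] by (simp add: add.commute)
  qed
  then show ?thesis unfolding phi_def by (intro the_equality) auto
qed

lemma cycle_len_in_stab: "of_nat (cycle_len \<psi> z) *s z \<in> stab \<psi>"
  using cycle_len_at_in_stab_at stab_eq cycle_len_eq by metis

end

end

section \<open>The torus and its configuration spaces\<close>

definition torus :: "(complex^'k) set" where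
  "torus = {x. \<forall>j. norm (x $ j) = 1}"

definition torus_cover :: "real^'k \<Rightarrow> complex^'k" where
  "torus_cover t = (\<chi> j. exp (2 * of_real pi * \<i> * of_real (t $ j)))"

definition ordered_config :: "((complex^'k)^'n) set" where
  "ordered_config = {x. (\<forall>i. x $ i \<in> torus) \<and> (\<forall>i j. i \<noteq> j \<longrightarrow> x $ i \<noteq> x $ j)}"

definition point_set :: "('a^'n) \<Rightarrow> 'a set" where
  "point_set x = range (\<lambda>i. x $ i)"

text \<open>
  \<open>D\<^sub>n(T\<^sup>k)\<close> with the quotient topology from \<open>F\<^sub>n(T\<^sup>k)\<close>. The fibres of \<open>point_set\<close> on \<open>F\<^sub>n(T\<^sup>k)\<close> are
  the orbits of the permutation action. The argument \<open>TYPE('n)\<close> carries the number \<open>n\<close> of points.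
\<close>
definition config_topology :: "'n::finite itself \<Rightarrow> (complex^'k) set topology" where
  "config_topology _ =
     topology (\<lambda>U. U \<subseteq> point_set ` (ordered_config :: ((complex^'k)^'n) set) \<and>
       openin (top_of_set (ordered_config :: ((complex^'k)^'n) set))
         {x \<in> ordered_config. point_set x \<in> U})"

lemma openin_config_topology:
  "openin (config_topology TYPE('n::finite)) U \<longleftrightarrow>
     U \<subseteq> point_set ` (ordered_config :: ((complex^'k)^'n) set) \<and>
     openin (top_of_set (ordered_config :: ((complex^'k)^'n) set))
       {x \<in> ordered_config. point_set x \<in> U}"
proof -
  let ?F = "ordered_config :: ((complex^'k)^'n) set"
  let ?P = "\<lambda>U. U \<subseteq> point_set ` ?F \<and> openin (top_of_set ?F) {x \<in> ?F. point_set x \<in> U}"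
  have "istopology ?P"
    unfolding istopology_def
  proof (intro conjI allI impI)
    fix U V assume U: "?P U" and V: "?P V"
    show "U \<inter> V \<subseteq> point_set ` ?F" using U by auto
    have "{x \<in> ?F. point_set x \<in> U \<inter> V} =
        {x \<in> ?F. point_set x \<in> U} \<inter> {x \<in> ?F. point_set x \<in> V}" by auto
    then show "openin (top_of_set ?F) {x \<in> ?F. point_set x \<in> U \<inter> V}"
      using U V by (simp only: openin_Int)
  next
    fix K assume K: "\<forall>U\<in>K. ?P U"
    show "\<Union> K \<subseteq> point_set ` ?F" using K by blast
    have "{x \<in> ?F. point_set x \<in> \<Union> K} = (\<Union>U\<in>K. {x \<in> ?F. point_set x \<in> U})" by auto
    then show "openin (top_of_set ?F) {x \<in> ?F. point_set x \<in> \<Union> K}"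
      using K by (auto simp only: intro!: openin_Union)
  qed
  then show ?thesis
    unfolding config_topology_def by (simp add: topology_inverse')
qed

lemma topspace_config_topology:
  "topspace (config_topology TYPE('n::finite)) =
     point_set ` (ordered_config :: ((complex^'k)^'n) set)" (is "_ = ?D")
proof
  show "topspace (config_topology TYPE('n)) \<subseteq> ?D"
    using openin_topspace openin_config_topology by blast
  have "{x \<in> ordered_config. point_set x \<in> ?D} = (ordered_config :: ((complex^'k)^'n) set)"
    by auto
  then have "openin (config_topology TYPE('n)) ?D"
    by (simp add: openin_config_topology)
  then show "?D \<subseteq> topspace (config_topology TYPE('n))"
    by (rule openin_subset)
qed

lemma quotient_map_point_set:
  "quotient_map (top_of_set (ordered_config :: ((complex^'k)^'n::finite) set))
     (config_topology TYPE('n)) point_set"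
  by (auto simp: quotient_map_def topspace_config_topology openin_config_topology)

lemma topspace_config_topology_card:
  "topspace (config_topology TYPE('n::finite)) =
     {X :: (complex^'k) set. X \<subseteq> torus \<and> finite X \<and> card X = CARD('n)}"
proof (intro equalityI subsetI)
  fix X :: "(complex^'k) set"
  assume "X \<in> topspace (config_topology TYPE('n))"
  then obtain x :: "(complex^'k)^'n" where x: "x \<in> ordered_config" "X = point_set x"
    by (auto simp: topspace_config_topology)
  have "inj (\<lambda>i. x $ i)"
    using x by (auto simp: inj_on_def ordered_config_def)
  then show "X \<in> {X. X \<subseteq> torus \<and> finite X \<and> card X = CARD('n)}"
    using x by (auto simp: point_set_def ordered_config_def card_image)
next
  fix X :: "(complex^'k) set"
  assume X: "X \<in> {X. X \<subseteq> torus \<and> finite X \<and> card X = CARD('n)}"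
  then obtain h :: "'n \<Rightarrow> complex^'k" where h: "bij_betw h UNIV X"
    using finite_same_card_bij[of "UNIV :: 'n set" X] by auto
  then have "(\<chi> i. h i) \<in> ordered_config" "X = point_set (\<chi> i. h i)"
    using X by (auto simp: ordered_config_def point_set_def bij_betw_def inj_on_def)
  then show "X \<in> topspace (config_topology TYPE('n))"
    by (auto simp: topspace_config_topology)
qed

section \<open>\<open>n\<close>-valued maps, lifts and induced morphisms\<close>

text \<open>Values of \<open>f\<close> off the torus are irrelevant.\<close>
definition n_valued_map :: "'n::finite itself \<Rightarrow> (complex^'k \<Rightarrow> (complex^'k) set) \<Rightarrow> bool" where
  "n_valued_map N f \<longleftrightarrow> continuous_map (top_of_set torus) (config_topology N) f"

definition cover_config :: "((real^'k)^'n) set" where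
  "cover_config = {x. \<forall>i j. i \<noteq> j \<longrightarrow> torus_cover (x $ i) \<noteq> torus_cover (x $ j)}"

definition cover_config_map :: "(real^'k)^'n \<Rightarrow> (complex^'k) set" where
  "cover_config_map x = range (\<lambda>i. torus_cover (x $ i))"

definition is_lift ::
    "(real^'k \<Rightarrow> (real^'k)^'n::finite) \<Rightarrow> (complex^'k \<Rightarrow> (complex^'k) set) \<Rightarrow> bool" where
  "is_lift F f \<longleftrightarrow>
     continuous_map euclidean (top_of_set cover_config) F \<and>
     (\<forall>t. cover_config_map (F t) = f (torus_cover t))"

definition affine_map :: "(real^'k \<Rightarrow> real^'k) \<Rightarrow> bool" where
  "affine_map g \<longleftrightarrow> (\<exists>(A :: real^'k^'k) a. \<forall>t. g t = A *v t + a)"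

definition affine_n_valued_map ::
    "'n::finite itself \<Rightarrow> (complex^'k \<Rightarrow> (complex^'k) set) \<Rightarrow> bool" where
  "affine_n_valued_map N f \<longleftrightarrow>
     n_valued_map N f \<and>
     (\<exists>F :: real^'k \<Rightarrow> (real^'k)^'n. is_lift F f \<and> (\<forall>i. affine_map (\<lambda>t. F t $ i)))"

definition real_vec :: "int^'k \<Rightarrow> real^'k" where
  "real_vec z = (\<chi> j. of_int (z $ j))"

text \<open>
  \<open>\<psi> = \<psi>\<^sub>F\<close>, expressed by the characterising property of \<open>\<psi>\<^sub>F\<close>. By \<open>induced_morphism_unique\<close>
  at most one \<open>\<psi>\<close> has it.
\<close>
definition is_induced_morphism ::
    "(real^'k \<Rightarrow> (real^'k)^'n::finite) \<Rightarrow> ('k::finite, 'n) morphism \<Rightarrow> bool" where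
  "is_induced_morphism F \<psi> \<longleftrightarrow>
     \<psi> \<in> hom Zk_group semidirect_group \<and>
     (\<forall>i t z. F (t + real_vec z) $ i =
        F t $ (inv' (sigma \<psi> z) i) + real_vec (phi_at \<psi> i z))"

lemma torus_cover_add_real_vec: "torus_cover (t + real_vec z) = torus_cover t"
proof -
  have "exp (2 * complex_of_real pi * \<i> * of_real (t $ j + of_int (z $ j))) =
      exp (2 * complex_of_real pi * \<i> * of_real (t $ j))" for j
    using exp_integer_2pi[of "of_int (z $ j)"]
    by (simp add: algebra_simps exp_add)
  then show ?thesis
    by (simp add: torus_cover_def real_vec_def vec_eq_iff)
qed

lemma induced_morphism_unique:
  assumes "is_lift F f" "is_induced_morphism F \<psi>" "is_induced_morphism F \<psi>'"
  shows "\<psi> = \<psi>'"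
proof
  fix z
  let ?s = "sigma \<psi> z" and ?s' = "sigma \<psi>' z"
  have hom: "\<psi> \<in> hom Zk_group semidirect_group" "\<psi>' \<in> hom Zk_group semidirect_group"
    using assms by (auto simp: is_induced_morphism_def)
  have F: "F 0 \<in> cover_config"
    using assms(1) by (auto simp: is_lift_def continuous_map_def)
  have eq: "F 0 $ (inv' ?s i) + real_vec (phi_at \<psi> i z) =
      F 0 $ (inv' ?s' i) + real_vec (phi_at \<psi>' i z)" for i
    using assms(2,3) unfolding is_induced_morphism_def by (metis (no_types))
  have inv_eq: "inv' ?s i = inv' ?s' i" for i
  proof (rule ccontr)
    assume "inv' ?s i \<noteq> inv' ?s' i"
    then have "torus_cover (F 0 $ (inv' ?s i)) \<noteq> torus_cover (F 0 $ (inv' ?s' i))"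
      using F by (auto simp: cover_config_def)
    moreover have "torus_cover (F 0 $ (inv' ?s i)) = torus_cover (F 0 $ (inv' ?s' i))"
      using arg_cong[OF eq[of i], of torus_cover] by (simp only: torus_cover_add_real_vec)
    ultimately show False by simp
  qed
  then have "inv' (inv' ?s) = inv' (inv' ?s')"
    by (simp add: ext[of "inv' ?s" "inv' ?s'"])
  then have "?s = ?s'"
    by (simp only: permutes_inv_inv[OF sigma_permutes[OF hom(1)]]
        permutes_inv_inv[OF sigma_permutes[OF hom(2)]])
  moreover have "phi_at \<psi> i z = phi_at \<psi>' i z" for i
    using eq[of i] inv_eq by (simp add: real_vec_def vec_eq_iff)
  ultimately show "\<psi> z = \<psi>' z"
    by (simp add: sigma_def phi_at_def prod_eq_iff vec_eq_iff)
qed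

definition induced_by_affine_map :: "('k::finite, 'n::finite) morphism \<Rightarrow> bool" where
  "induced_by_affine_map \<psi> \<longleftrightarrow>
     (\<exists>f (F :: real^'k \<Rightarrow> (real^'k)^'n).
        affine_n_valued_map TYPE('n) f \<and> is_lift F f \<and> is_induced_morphism F \<psi>)"

end

theory Submission
  imports Defs
begin

text \<open>
  Because \<open>S\<close> has finite index in \<open>\<int>\<^sup>k\<close>, the morphism \<open>\<phi>\<close> extends uniquely to a linear map
  \<open>A\<close> of \<open>\<real>\<^sup>k\<close>, and \<open>A z = \<phi>(n\<^sub>z z) / n\<^sub>z\<close> for \<open>z \<in> \<int>\<^sup>k\<close>. The condition of the theorem therefore
  says that \<open>A\<close> takes no \<open>z \<in> \<int>\<^sup>k\<close> outside \<open>S\<close> to an integer vector.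

  An affine lift \<open>F\<close> inducing \<open>\<psi>\<close> must satisfy \<open>F\<^sub>i(t + s) = F\<^sub>i(t) + \<phi>(s)\<close> for \<open>s \<in> S\<close>, so each
  \<open>F\<^sub>i\<close> has linear part \<open>A\<close>. If \<open>A z\<close> were integral for some \<open>z \<notin> S\<close>, then \<open>F\<^sub>i(0)\<close>, \<open>F\<^sub>i(z)\<close>
  and \<open>F\<^sub>j(0)\<close> with \<open>j = \<sigma>\<^sub>z\<^sup>-\<^sup>1(i) \<noteq> i\<close> would all agree modulo \<open>\<int>\<^sup>k\<close>, although the points of
  \<open>F(0)\<close> lie over distinct points of the torus (\<open>induced_by_affine_map_imp\<close>). The lift
  inducing \<open>\<psi>\<close> may differ from the one whose lift-factors are known to be affine, but two lifts of
  one map differ only by a relabelling and integer translations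
  (\<open>lift_factors_differ_by_translation\<close>), so it is affine as well.

  Conversely, the family \<open>F\<^sub>i(t) = A t + a\<^sub>i\<close> induces \<open>\<psi>\<close> if and only if
  \<open>A z + a\<^sub>i = a\<^sub>j + \<phi>\<^sub>i(z)\<close> for all \<open>i\<close> and \<open>z\<close>, with \<open>j = \<sigma>\<^sub>z\<^sup>-\<^sup>1(i)\<close>. Irreducibility lets one
  start from \<open>a\<^sub>b = 0\<close> at one label \<open>b\<close> and transport it to the others; that \<open>A\<close> extends \<open>\<phi>\<close> makes
  the result independent of the path (\<open>equivariant_translations\<close>). By the same relation, if
  \<open>a\<^sub>i - a\<^sub>j\<close> is integral with \<open>i \<noteq> j\<close>, then \<open>A z\<close> is integral for any \<open>z\<close> with
  \<open>\<sigma>\<^sub>z(j) = i\<close>, and such a \<open>z\<close> is outside \<open>S\<close>. So the condition is exactly what keeps the points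
  \<open>F\<^sub>i(t)\<close> distinct on the torus.
\<close>

section \<open>The covering map of the torus\<close>

lemma real_vec_add: "real_vec (z + w) = real_vec z + real_vec w"
  by (simp add: real_vec_def vec_eq_iff)

lemma real_vec_diff: "real_vec (z - w) = real_vec z - real_vec w"
  by (simp add: real_vec_def vec_eq_iff)

lemma real_vec_of_nat_scale: "real_vec (of_nat m *s z) = of_nat m *\<^sub>R real_vec z"
  by (simp add: real_vec_def vec_eq_iff)

lemma of_nat_Suc_scale: "(of_nat (Suc m) :: int) *s v = v + of_nat m *s v"
  by (simp add: vec_eq_iff algebra_simps)

lemma real_vec_eq_iff: "real_vec z = real_vec w \<longleftrightarrow> z = w"
  by (simp add: real_vec_def vec_eq_iff)

lemma torus_cover_eq_iff: "torus_cover x = torus_cover y \<longleftrightarrow> (\<exists>w. x = y + real_vec w)"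
proof
  assume eq: "torus_cover x = torus_cover y"
  have "\<exists>m::int. x $ j = y $ j + of_int m" for j
  proof -
    have "exp (2 * of_real pi * \<i> * of_real (x $ j)) = exp (2 * of_real pi * \<i> * of_real (y $ j))"
      using eq by (simp add: torus_cover_def vec_eq_iff)
    then obtain m :: int where
      "2 * of_real pi * \<i> * of_real (x $ j)
        = 2 * of_real pi * \<i> * of_real (y $ j) + of_int (2 * m) * pi * \<i>"
      unfolding exp_eq by auto
    then have "2 * of_real pi * \<i> * complex_of_real (x $ j)
        = 2 * of_real pi * \<i> * complex_of_real (y $ j + of_int m)"
      by (simp add: algebra_simps)
    then have "complex_of_real (x $ j) = complex_of_real (y $ j + of_int m)"
      by (simp only: mult_cancel_left) simp
    then show ?thesis
      by (metis of_real_eq_iff)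
  qed
  then obtain m :: "'a \<Rightarrow> int" where "\<And>j. x $ j = y $ j + of_int (m j)"
    by metis
  then have "x = y + real_vec (\<chi> j. m j)"
    by (simp add: real_vec_def vec_eq_iff)
  then show "\<exists>w. x = y + real_vec w" ..
qed (auto simp: torus_cover_add_real_vec)

lemma continuous_on_torus_cover: "continuous_on X torus_cover"
  unfolding torus_cover_def by (intro continuous_intros)

lemma torus_cover_in_torus: "torus_cover t \<in> torus"
  by (simp add: torus_def torus_cover_def norm_exp_eq_Re)

lemma torus_cover_image_cube: "torus_cover ` cbox 0 1 = torus"
proof (intro equalityI subsetI)
  fix x :: "complex^'a"
  assume x: "x \<in> torus"
  have "\<exists>s::real. 0 \<le> s \<and> s \<le> 1 \<and> x $ j = exp (2 * of_real pi * \<i> * of_real s)" for j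
  proof -
    have "norm (x $ j) = 1"
      using x by (simp add: torus_def)
    then obtain r where r: "0 \<le> r" "r < 2 * pi" "x $ j = exp (\<i> * of_real r)"
      using complex_unimodular_polar by (metis cis_conv_exp complex.sel cis.ctr)
    then show ?thesis
      by (intro exI[of _ "r / (2 * pi)"]) (auto simp: field_simps)
  qed
  then obtain s :: "'a \<Rightarrow> real" where
    "\<And>j. 0 \<le> s j \<and> s j \<le> 1 \<and> x $ j = exp (2 * of_real pi * \<i> * of_real (s j))"
    by metis
  then show "x \<in> torus_cover ` cbox 0 1"
    by (intro image_eqI[of _ _ "\<chi> j. s j"])
      (auto simp: torus_cover_def vec_eq_iff mem_box_cart)
qed (auto simp: torus_cover_in_torus)

text \<open>
  A continuous surjection from a compact space to a Hausdorff space is a quotient map. Restricting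
  the covering to a cube thus reduces continuity of a function on the torus to continuity of its
  pullback, without local sections.
\<close>
lemma quotient_map_torus_cover_cube:
  "quotient_map (top_of_set (cbox 0 1)) (top_of_set torus) torus_cover"
proof (rule continuous_imp_quotient_map)
  show "continuous_map (top_of_set (cbox 0 1)) (top_of_set torus) torus_cover"
    by (auto simp: continuous_on_torus_cover torus_cover_in_torus)
  show "compact_space (top_of_set (cbox (0 :: real^'a) 1))"
    by (simp add: compact_space_subtopology)
  show "Hausdorff_space (top_of_set (torus :: (complex^'a) set))"
    by (simp add: Hausdorff_space_subtopology)
qed (simp add: torus_cover_image_cube)

section \<open>Lifts of affine maps\<close>

lemma continuous_on_is_lift:
  assumes "is_lift F f"
  shows "continuous_on X (\<lambda>t. F t $ i)"
proof -
  have "continuous_on UNIV F"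
    using assms by (simp add: is_lift_def continuous_map_in_subtopology)
  then show ?thesis
    by (intro continuous_on_component) (rule continuous_on_subset[OF _ subset_UNIV])
qed

lemma is_lift_distinct:
  assumes "is_lift F f" "torus_cover (F t $ i) = torus_cover (F t $ j)"
  shows "i = j"
  using assms by (auto simp: is_lift_def cover_config_def continuous_map_in_subtopology)

text \<open>
  Sending \<open>t\<close> to the label \<open>j\<close> for which \<open>F\<^sub>i(t)\<close> and \<open>G\<^sub>j(t)\<close> lie over the same point partitions
  \<open>\<real>\<^sup>k\<close> into finitely many closed sets, so by connectedness \<open>j\<close> is constant. The difference
  \<open>F\<^sub>i - G\<^sub>j\<close> is then continuous with integer coordinates, hence constant too.
\<close>
lemma lift_factors_differ_by_translation:
  fixes F G :: "real^'k \<Rightarrow> (real^'k)^'n::finite"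
  assumes F: "is_lift F f" and G: "is_lift G f"
  shows "\<exists>j c. \<forall>t. F t $ i = G t $ j + c"
proof -
  define C where "C j = {t. torus_cover (F t $ i) = torus_cover (G t $ j)}" for j
  have closed: "closed (C j)" for j
    unfolding C_def
    by (intro closed_Collect_eq continuous_on_compose2[OF continuous_on_torus_cover[of UNIV]]
        continuous_on_is_lift[OF F] continuous_on_is_lift[OF G]) auto
  have some_label: "\<exists>j. t \<in> C j" for t
  proof -
    have "cover_config_map (F t) = cover_config_map (G t)"
      using F G by (simp add: is_lift_def)
    then show ?thesis
      unfolding cover_config_map_def C_def by blast
  qed
  then obtain j where j: "0 \<in> C j"
    by blast
  have disjoint: "C j \<inter> C l = {}" if "l \<noteq> j" for l
    using that is_lift_distinct[OF G] by (force simp: C_def)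
  have "closed (\<Union>l\<in>-{j}. C l)"
    by (intro closed_UN closed ballI) auto
  moreover have cover: "UNIV \<subseteq> C j \<union> (\<Union>l\<in>-{j}. C l)"
    using some_label by blast
  moreover have "C j \<inter> (\<Union>l\<in>-{j}. C l) = {}"
    using disjoint by blast
  ultimately have "C j \<inter> UNIV = {} \<or> (\<Union>l\<in>-{j}. C l) \<inter> UNIV = {}"
    by - (rule connected_closedD[OF connected_UNIV _ _ closed[of j]], auto)
  with j have "(\<Union>l\<in>-{j}. C l) = {}"
    by auto
  with cover have "C j = UNIV"
    by (simp only: Un_empty_right top.extremum_unique)
  then have integral: "\<exists>w. F t $ i = G t $ j + real_vec w" for t
    by (auto simp: C_def set_eq_iff torus_cover_eq_iff)
  define D where "D t = F t $ i - G t $ j" for t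
  have "D t = D 0" for t
  proof -
    have "D t $ r = D 0 $ r" for r
    proof -
      have "continuous_on UNIV (\<lambda>t. D t $ r)"
        unfolding D_def
        by (intro continuous_intros continuous_on_is_lift[OF F] continuous_on_is_lift[OF G])
      moreover have "D t $ r \<in> \<int>" for t
        using integral[of t] by (auto simp: D_def real_vec_def)
      then have "\<exists>e>0. \<forall>u. u \<in> UNIV \<and> D u $ r \<noteq> D t $ r \<longrightarrow> e \<le> norm (D u $ r - D t $ r)" for t
        by (intro exI[of _ 1]) (auto intro: Ints_nonzero_abs_ge1)
      ultimately have "(\<lambda>t. D t $ r) constant_on UNIV"
        by (intro continuous_discrete_range_constant[OF connected_UNIV]) auto
      then show ?thesis
        by (auto simp: constant_on_def)
    qed
    then show ?thesis
      by (simp add: vec_eq_iff)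
  qed
  then have "\<forall>t. F t $ i = G t $ j + D 0"
    by (metis D_def add.commute diff_add_cancel)
  then show ?thesis
    by blast
qed

lemma lift_of_affine_map_is_affine:
  fixes F :: "real^'k \<Rightarrow> (real^'k)^'n::finite"
  assumes "affine_n_valued_map TYPE('n) f" "is_lift F f"
  shows "affine_map (\<lambda>t. F t $ i)"
proof -
  obtain G :: "real^'k \<Rightarrow> (real^'k)^'n" where
    G: "is_lift G f" "\<And>j. affine_map (\<lambda>t. G t $ j)"
    using assms(1) by (auto simp: affine_n_valued_map_def)
  obtain j c where c: "\<And>t. F t $ i = G t $ j + c"
    using lift_factors_differ_by_translation[OF assms(2) G(1)] by metis
  obtain A :: "real^'k^'k" and a where "\<And>t. G t $ j = A *v t + a"
    using G(2)[of j] by (auto simp: affine_map_def)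
  then show ?thesis
    unfolding affine_map_def by (intro exI[of _ A] exI[of _ "a + c"]) (simp add: c add.assoc)
qed

section \<open>Maps of the torus from periodic configurations\<close>

text \<open>
  The formula \<open>f(p(t)) = p\<^sup>n(F(t))\<close> defines \<open>f\<close>, and it is continuous since on a cube it factors as
  \<open>point_set\<close> after a continuous map into the ordered configuration space.
\<close>
lemma n_valued_map_of_periodic:
  fixes F :: "real^'k \<Rightarrow> (real^'k)^'n::finite"
  assumes cont: "continuous_on UNIV F"
    and distinct: "\<And>t. F t \<in> cover_config"
    and periodic: "\<And>t z. cover_config_map (F (t + real_vec z)) = cover_config_map (F t)"
  shows "\<exists>f. n_valued_map TYPE('n) f \<and> is_lift F f"
proof -
  define s where "s = inv_into (UNIV :: (real^'k) set) torus_cover"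
  define f where "f x = cover_config_map (F (s x))" for x
  have f_cover: "f (torus_cover t) = cover_config_map (F t)" for t
  proof -
    have "torus_cover (s (torus_cover t)) = torus_cover t"
      unfolding s_def by (intro f_inv_into_f) auto
    then obtain z where "s (torus_cover t) = t + real_vec z"
      unfolding torus_cover_eq_iff by auto
    then show ?thesis
      by (simp add: f_def periodic)
  qed
  define P where "P t = (\<chi> i. torus_cover (F t $ i))" for t
  have "continuous_on (cbox 0 1) P"
    unfolding P_def
    by (intro continuous_on_vec_lambda continuous_on_compose2[OF continuous_on_torus_cover[of UNIV]]
        continuous_on_component continuous_on_subset[OF cont]) auto
  moreover have "P t \<in> ordered_config" for t
    using distinct[of t] by (simp add: P_def ordered_config_def cover_config_def torus_cover_in_torus)
  ultimately have "continuous_map (top_of_set (cbox 0 1)) (top_of_set ordered_config) P"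
    by (auto simp: continuous_map_in_subtopology)
  then have "continuous_map (top_of_set (cbox 0 1)) (config_topology TYPE('n)) (point_set \<circ> P)"
    by (rule continuous_map_compose[OF _ quotient_imp_continuous_map[OF quotient_map_point_set]])
  moreover have "point_set \<circ> P = f \<circ> torus_cover"
    by (auto simp: fun_eq_iff f_cover P_def point_set_def cover_config_map_def)
  ultimately have "n_valued_map TYPE('n) f"
    unfolding n_valued_map_def
    by (simp add: continuous_compose_quotient_map_eq[OF quotient_map_torus_cover_cube])
  moreover have "is_lift F f"
    using cont distinct by (auto simp: is_lift_def f_cover continuous_map_in_subtopology)
  ultimately show ?thesis
    by blast
qed

section \<open>Linear extension of additive maps\<close>

lemma additive_matrix:
  fixes g :: "int^'k::finite \<Rightarrow> int^'m::finite"
  assumes "Modules.additive g"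
  shows "\<exists>A. \<forall>z. real_vec (g z) = A *v real_vec z"
proof -
  interpret Modules.additive g by fact
  have axis: "g (axis j m) = m *s g (axis j 1)" for j m
  proof -
    interpret h: Modules.additive "\<lambda>m. g (axis j m)"
    proof
      show "g (axis j (x + y)) = g (axis j x) + g (axis j y)" for x y
        unfolding add[symmetric] by (rule arg_cong[of _ _ g]) (simp add: axis_def vec_eq_iff)
    qed
    show ?thesis
    proof (induction m rule: int_induct[of _ 0])
      case base
      show ?case by (simp add: h.zero)
    qed (simp_all add: h.add h.diff vector_sadd_rdistrib vector_ssub_ldistrib algebra_simps vec_eq_iff)
  qed
  define A where "A = (\<chi> r c. real_of_int (g (axis c 1) $ r))"
  have "real_vec (g z) = A *v real_vec z" for z
  proof -
    have "z = (\<Sum>j\<in>UNIV. axis j (z $ j))"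
      by (simp add: vec_eq_iff axis_def)
    then have "g z = (\<Sum>j\<in>UNIV. z $ j *s g (axis j 1))"
      by (metis (no_types, lifting) sum axis sum.cong)
    then show ?thesis
      by (simp add: A_def real_vec_def matrix_vector_mult_def vec_eq_iff mult.commute)
  qed
  then show ?thesis
    by blast
qed

text \<open>
  The map \<open>z \<mapsto> \<phi>(N z)\<close> is defined and additive on all of \<open>\<int>\<^sup>k\<close>, so it is given by a matrix \<open>B\<close>;
  then \<open>B / N\<close> extends \<open>\<phi>\<close>.
\<close>
lemma finite_exponent_linear_extension:
  fixes \<phi> :: "int^'k::finite \<Rightarrow> int^'m::finite"
  assumes "N > 0" and multiples: "\<And>z. of_nat N *s z \<in> S"
    and add: "\<And>x y. x \<in> S \<Longrightarrow> y \<in> S \<Longrightarrow> \<phi> (x + y) = \<phi> x + \<phi> y"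
    and closed: "\<And>x y. x \<in> S \<Longrightarrow> y \<in> S \<Longrightarrow> x + y \<in> S"
  shows "\<exists>A. \<forall>s\<in>S. real_vec (\<phi> s) = A *v real_vec s"
proof -
  have "Modules.additive (\<lambda>z. \<phi> (of_nat N *s z))"
    by unfold_locales (simp add: vector_add_ldistrib add multiples)
  then obtain B where B: "\<And>z. real_vec (\<phi> (of_nat N *s z)) = B *v real_vec z"
    using additive_matrix by blast
  \<comment> \<open>Closure under addition gives the positive multiples only, hence \<open>Suc m\<close> in place of \<open>m\<close>.\<close>
  have scale: "of_nat (Suc m) *s s \<in> S \<and> \<phi> (of_nat (Suc m) *s s) = of_nat (Suc m) *s \<phi> s"
    if s: "s \<in> S" for m s
  proof (induction m)
    case (Suc m)
    then show ?case
      using s by (simp only: of_nat_Suc_scale[of "Suc m"] add closed)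
  qed (simp add: s)
  have "real_vec (\<phi> s) = ((1 / real N) *\<^sub>R B) *v real_vec s" if "s \<in> S" for s
  proof -
    have "of_nat N *\<^sub>R real_vec (\<phi> s) = B *v real_vec s"
      using scale[OF that, of "N - 1"] \<open>N > 0\<close> B[of s]
      by (simp flip: real_vec_of_nat_scale)
    then show ?thesis
      using \<open>N > 0\<close> by (simp flip: scaleR_matrix_vector_assoc add: eq_vector_fraction_iff)
  qed
  then show ?thesis
    by blast
qed

section \<open>Irreducible morphisms\<close>

context
  fixes \<psi> :: "('k::finite, 'n::finite) morphism"
  assumes hom: "\<psi> \<in> hom Zk_group semidirect_group"
    and irr: "irreducible_morphism \<psi>"
begin

lemma inv_sigma_eq_iff: "inv' (sigma \<psi> z) i = j \<longleftrightarrow> sigma \<psi> z j = i"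
  using permutes_inverses[OF sigma_permutes[OF hom, of z]] by metis

lemma stab_iff_inv_fixes: "z \<in> stab \<psi> \<longleftrightarrow> inv' (sigma \<psi> z) i = i"
  by (simp add: inv_sigma_eq_iff stab_eq[OF hom irr, of i] stab_at_def)

lemma cycle_len_pos: "cycle_len \<psi> z > 0"
proof -
  fix i :: 'n
  have "sigma \<psi> z i \<in> orbit (sigma \<psi> z) i"
    by (rule orbit.base)
  then show ?thesis
    by (auto simp: cycle_len_eq[OF hom irr, of z i] cycle_len_at_def card_gt_0_iff)
qed

lemma stab_add: "x \<in> stab \<psi> \<Longrightarrow> y \<in> stab \<psi> \<Longrightarrow> x + y \<in> stab \<psi>"
  by (simp add: stab_eq[OF hom irr, of undefined] stab_at_def sigma_add[OF hom])

lemma phi_at_stab_add: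
  assumes "x \<in> stab \<psi>"
  shows "phi_at \<psi> i (x + y) = phi \<psi> x + phi_at \<psi> i y"
  using assms stab_iff_inv_fixes[of x i]
  by (simp add: phi_at_add[OF hom] phi_eq[OF hom irr, of x i])

text \<open>
  Each \<open>n\<^sub>z\<close> is at most \<open>n\<close>, hence divides \<open>n!\<close>, which therefore serves as a multiplier that is
  uniform in \<open>z\<close>.
\<close>
lemma fact_multiple_in_stab: "of_nat (fact CARD('n)) *s z \<in> stab \<psi>"
proof -
  define c where "c = cycle_len \<psi> z"
  have "c \<le> CARD('n)"
    unfolding c_def cycle_len_eq[OF hom irr, of z undefined] cycle_len_at_def
    by (intro card_mono) auto
  then have "c dvd fact CARD('n)"
    using cycle_len_pos[of z] by (intro dvd_fact) (auto simp: c_def)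
  then obtain d where d: "fact CARD('n) = c * d" ..
  have "of_nat d *s (of_nat c *s z) \<in> stab \<psi>"
  proof (induction d)
    case 0
    show ?case
      by (simp add: stab_eq[OF hom irr, of undefined] stab_at_def sigma_zero[OF hom])
  next
    case (Suc d)
    then show ?case
      using cycle_len_in_stab[OF hom irr, of z] by (simp only: of_nat_Suc_scale stab_add c_def)
  qed
  then show ?thesis
    by (simp add: d vector_smult_assoc mult.commute)
qed

lemma phi_linear_extension: "\<exists>A. \<forall>s\<in>stab \<psi>. real_vec (phi \<psi> s) = A *v real_vec s"
proof (rule finite_exponent_linear_extension)
  show "phi \<psi> (x + y) = phi \<psi> x + phi \<psi> y" if "x \<in> stab \<psi>" "y \<in> stab \<psi>" for x y
    using that phi_at_stab_add[of x undefined y] phi_eq[OF hom irr] stab_add by metis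
  show "of_nat (fact CARD('n)) *s z \<in> stab \<psi>" for z
    by (rule fact_multiple_in_stab)
qed (simp_all add: stab_add)

text \<open>
  If \<open>\<phi>(n\<^sub>z z) = n\<^sub>z w\<close>, then a lift-factor with linear part \<open>A\<close> satisfies \<open>A z = w\<close>. Evaluating at
  \<open>z\<close> shows that \<open>F\<^sub>i(0)\<close> and \<open>F\<^sub>j(0)\<close> lie over the same point, where
  \<open>j = \<sigma>\<^sub>z\<^sup>-\<^sup>1(i)\<close> differs from \<open>i\<close> as \<open>z \<notin> S\<close>.
\<close>
lemma induced_by_affine_map_imp:
  assumes "induced_by_affine_map \<psi>" and z: "z \<notin> stab \<psi>"
  shows "phi \<psi> (of_nat (cycle_len \<psi> z) *s z) \<noteq> of_nat (cycle_len \<psi> z) *s w"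
proof
  define c where "c = cycle_len \<psi> z"
  assume "phi \<psi> (of_nat (cycle_len \<psi> z) *s z) = of_nat (cycle_len \<psi> z) *s w"
  then have phi: "phi \<psi> (of_nat c *s z) = of_nat c *s w"
    by (simp add: c_def)
  obtain f and F :: "real^'k \<Rightarrow> (real^'k)^'n" where F:
    "affine_n_valued_map TYPE('n) f" "is_lift F f" "is_induced_morphism F \<psi>"
    using assms(1) by (auto simp: induced_by_affine_map_def)
  have shift: "F (t + real_vec x) $ i = F t $ (inv' (sigma \<psi> x) i) + real_vec (phi_at \<psi> i x)" for t x i
    using F(3) by (simp add: is_induced_morphism_def)
  fix i :: 'n
  obtain A :: "real^'k^'k" and a where A: "\<And>t. F t $ i = A *v t + a"
    using lift_of_affine_map_is_affine[OF F(1,2), of i] by (auto simp: affine_map_def)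
  have cz: "of_nat c *s z \<in> stab \<psi>"
    using cycle_len_in_stab[OF hom irr] by (simp add: c_def)
  have "A *v (of_nat c *\<^sub>R real_vec z) = of_nat c *\<^sub>R real_vec w"
    using shift[of 0 "of_nat c *s z" i] cz stab_iff_inv_fixes[of "of_nat c *s z" i]
      phi_eq[OF hom irr cz, of i, symmetric] phi
    by (simp add: A real_vec_of_nat_scale)
  then have Az: "A *v real_vec z = real_vec w"
    using cycle_len_pos[of z] by (simp add: matrix_vector_mult_scaleR c_def)
  define j where "j = inv' (sigma \<psi> z) i"
  have "F 0 $ i + real_vec w = F 0 $ j + real_vec (phi_at \<psi> i z)"
    using shift[of 0 z i] by (simp add: A Az j_def add.commute)
  then have "torus_cover (F 0 $ i) = torus_cover (F 0 $ j)"
    by (metis torus_cover_add_real_vec)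
  then have "i = j"
    by (rule is_lift_distinct[OF F(2)])
  then show False
    using z stab_iff_inv_fixes[of z i] by (simp add: j_def)
qed

text \<open>
  With \<open>a\<^sub>b = 0\<close> at a base label \<open>b\<close>, the relation for \<open>i = b\<close> forces \<open>a\<^sub>j = A x - \<phi>\<^sub>b(x)\<close> whenever
  \<open>\<sigma>\<^sub>x(j) = b\<close>. Two such \<open>x\<close> differ by an element of \<open>S\<close>, where \<open>A\<close> and \<open>\<phi>\<^sub>b\<close> agree, so this is
  well defined; the relation for the other labels is the cocycle identity for \<open>\<phi>\<^sub>b\<close>.
\<close>
lemma equivariant_translations:
  fixes A :: "real^'k^'k"
  assumes A: "\<And>s. s \<in> stab \<psi> \<Longrightarrow> real_vec (phi \<psi> s) = A *v real_vec s"
  shows "\<exists>a. \<forall>i z. A *v real_vec z + a i = a (inv' (sigma \<psi> z) i) + real_vec (phi_at \<psi> i z)"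
proof -
  fix b :: 'n
  define h where "h z = A *v real_vec z - real_vec (phi_at \<psi> b z)" for z
  have h_stab: "h (s + z) = h z" if "s \<in> stab \<psi>" for s z
    using that by (simp add: h_def phi_at_stab_add real_vec_add A matrix_vector_right_distrib)
  have h_cong: "h x = h y" if "sigma \<psi> x i = b" "sigma \<psi> y i = b" for x y i
  proof -
    have "sigma \<psi> y (sigma \<psi> (x - y) i) = sigma \<psi> y i"
      using that sigma_add[OF hom, of y "x - y"] by (simp add: comp_def fun_eq_iff)
    then have "sigma \<psi> (x - y) i = i"
      using permutes_inj[OF sigma_permutes[OF hom]] by (metis injD)
    then have "x - y \<in> stab \<psi>"
      by (simp add: stab_eq[OF hom irr, of i] stab_at_def)
    from h_stab[OF this, of y] show ?thesis
      by simp
  qed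
  have "\<forall>i. \<exists>x. sigma \<psi> x i = b"
    using irr by (simp add: irreducible_morphism_def)
  then obtain x where x: "\<And>i. sigma \<psi> (x i) i = b"
    by (auto dest!: choice)
  define a where "a i = h (x i)" for i
  have "A *v real_vec z + a i = a (inv' (sigma \<psi> z) i) + real_vec (phi_at \<psi> i z)" for i z
  proof -
    define j where "j = inv' (sigma \<psi> z) i"
    have j: "sigma \<psi> z j = i"
      by (simp add: j_def flip: inv_sigma_eq_iff)
    then have "a j = h (x i + z)"
      unfolding a_def by (intro h_cong[of _ j]) (simp_all add: x sigma_add[OF hom])
    moreover have "inv' (sigma \<psi> (x i)) b = i"
      by (simp add: inv_sigma_eq_iff x)
    ultimately show ?thesis
      by (simp add: a_def h_def phi_at_add[OF hom] real_vec_add matrix_vector_right_distrib flip: j_def)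
  qed
  then show ?thesis
    by blast
qed

text \<open>
  The condition enters only in showing that the points \<open>A t + a\<^sub>i\<close> are distinct modulo \<open>\<int>\<^sup>k\<close>: an
  integral difference \<open>a\<^sub>i - a\<^sub>j\<close> would make \<open>A z\<close> integral for a \<open>z \<notin> S\<close> that moves \<open>j\<close> to \<open>i\<close>.
\<close>
lemma induced_by_affine_map_if:
  assumes cond: "\<And>z w. z \<notin> stab \<psi> \<Longrightarrow>
      phi \<psi> (of_nat (cycle_len \<psi> z) *s z) \<noteq> of_nat (cycle_len \<psi> z) *s w"
  shows "induced_by_affine_map \<psi>"
proof -
  obtain A where A: "\<And>s. s \<in> stab \<psi> \<Longrightarrow> real_vec (phi \<psi> s) = A *v real_vec s"
    using phi_linear_extension by blast
  obtain a where a: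
    "\<And>i z. A *v real_vec z + a i = a (inv' (sigma \<psi> z) i) + real_vec (phi_at \<psi> i z)"
    using equivariant_translations[OF A] by blast
  define F where "F t = (\<chi> i. A *v t + a i)" for t
  have shift: "F (t + real_vec z) $ i = F t $ (inv' (sigma \<psi> z) i) + real_vec (phi_at \<psi> i z)" for t z i
    using a[of z i] by (simp add: F_def matrix_vector_right_distrib add.assoc)
  have "continuous_on UNIV F"
    unfolding F_def by (intro continuous_intros)
  moreover have "F t \<in> cover_config" for t
  proof -
    have "i = j" if eq: "torus_cover (F t $ i) = torus_cover (F t $ j)" for i j
    proof (rule ccontr)
      assume "i \<noteq> j"
      obtain v where v: "a i = a j + real_vec v"
        using eq by (auto simp: F_def torus_cover_eq_iff algebra_simps)
      obtain z where z: "inv' (sigma \<psi> z) i = j"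
        using irr by (auto simp: irreducible_morphism_def inv_sigma_eq_iff)
      then have "z \<notin> stab \<psi>"
        using \<open>i \<noteq> j\<close> stab_iff_inv_fixes[of z i] by simp
      define c where "c = cycle_len \<psi> z"
      define w where "w = phi_at \<psi> i z - v"
      have "A *v real_vec z = real_vec w"
        using a[of z i] by (simp add: z v w_def real_vec_diff algebra_simps)
      then have "real_vec (phi \<psi> (of_nat c *s z)) = real_vec (of_nat c *s w)"
        using A[OF cycle_len_in_stab[OF hom irr, of z]]
        by (simp add: c_def real_vec_of_nat_scale matrix_vector_mult_scaleR)
      then show False
        using cond[OF \<open>z \<notin> stab \<psi>\<close>, of w] by (simp add: real_vec_eq_iff c_def)
    qed
    then show ?thesis
      by (auto simp: cover_config_def)
  qed
  moreover have "cover_config_map (F (t + real_vec z)) = cover_config_map (F t)" for t z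
  proof -
    have "cover_config_map (F (t + real_vec z)) = range (\<lambda>i. torus_cover (F t $ (inv' (sigma \<psi> z) i)))"
      by (simp only: cover_config_map_def shift torus_cover_add_real_vec)
    also have "\<dots> = (\<lambda>i. torus_cover (F t $ i)) ` range (inv' (sigma \<psi> z))"
      by (simp add: image_image)
    also have "range (inv' (sigma \<psi> z)) = UNIV"
      by (rule permutes_surj[OF permutes_inv[OF sigma_permutes[OF hom]]])
    finally show ?thesis
      by (simp add: cover_config_map_def)
  qed
  ultimately obtain f where f: "n_valued_map TYPE('n) f" "is_lift F f"
    using n_valued_map_of_periodic by blast
  have "affine_map (\<lambda>t. F t $ i)" for i
    unfolding affine_map_def F_def by (intro exI[of _ A] exI[of _ "a i"]) simp
  with f have "affine_n_valued_map TYPE('n) f"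
    by (auto simp: affine_n_valued_map_def)
  moreover have "is_induced_morphism F \<psi>"
    by (simp add: is_induced_morphism_def hom shift)
  ultimately show ?thesis
    using f by (auto simp: induced_by_affine_map_def)
qed

end

theorem theorem2p7:
  fixes \<psi> :: "int^'k::finite \<Rightarrow> ((int^'k)^'n::finite) \<times> ('n \<Rightarrow> 'n)"
  assumes "\<psi> \<in> hom Zk_group semidirect_group"
    and "irreducible_morphism \<psi>"
  shows "induced_by_affine_map \<psi> \<longleftrightarrow>
    (\<forall>z. z \<notin> stab \<psi> \<longrightarrow>
      phi \<psi> (of_nat (cycle_len \<psi> z) *s z) \<notin> range (\<lambda>w :: int^'k. of_nat (cycle_len \<psi> z) *s w))"
  using induced_by_affine_map_imp[OF assms] induced_by_affine_map_if[OF assms] by blast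

end
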